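(* Let $p\in(0,1)$ and let $k\ge 1$ be an integer. Let $\mathcal{A}:\mathbb{R}^{m\times n}\to\mathbb{R}^l$ be a given linear operator with $m\le n$. Suppose that for any orthogonal matrices $U\in\mathbb{R}^{m\times m}$ and $V\in\mathbb{R}^{n\times n}$, the matrix $A_{U,V}\in\mathbb{R}^{l\times m}$ of the linear map $x\mapsto \mathcal{A}\left(U\,[\,\mathrm{Diag}(x)\;\;\mathbf{0}\,]\,V^T\right)$ from $\mathbb{R}^m$ to $\mathbb{R}^l$ belongs to $\mathscr{S}_k^p$. Then every matrix $\bar{X}\in\mathbb{R}^{m\times n}$ with $\mathrm{rank}(\bar{X})\le k$ and $y=\mathcal{A}(\bar{X})\in\mathbb{R}^l$ can be exactly recovered by solving $$\text{minimize } \|X\|_p^p \quad\text{subject to } \mathcal{A}(X)=y,\; X\in\mathbb{R}^{m\times n}.$$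
   Context: For $x\in\mathbb{R}^m$, $\mathrm{Diag}(x)$ is the $m\times m$ diagonal matrix with $x$ on the diagonal, and $[\,\mathrm{Diag}(x)\;\;\mathbf{0}\,]$ is the $m\times n$ matrix obtained by appending $n-m$ zero columns. For a matrix $X\in\mathbb{R}^{m\times n}$ with $m\le n$, $\|X\|_p^p=\sum_{i=1}^{m}\sigma_i(X)^p$, where $\sigma_i(X)$ is the $i$-th largest singular value. For a vector $x\in\mathbb{R}^t$, $\|x\|_p^p=\sum_{i=1}^t|x_i|^p$ and $\|x\|_0=|\{i:x_i\neq 0\}|$. $\mathscr{S}_k^p$ denotes the set of real $s\times t$ matrices $A$ (with $t\ge k$) such that every vector $\bar{x}\in\mathbb{R}^t$ with $\|\bar{x}\|_0\le k$ and $y=A\bar{x}$ can be exactly recovered by solving: minimize $\|x\|_p^p$ subject to $Ax=y$, $x\in\mathbb{R}^t$. In both the vector and matrix settings, "exactly recovered by solving" an optimization problem means that the given vector (matrix) is the unique optimal solution of that problem. *)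

theory Defs
  imports "HOL-Analysis.Analysis" "HOL-Computational_Algebra.Computational_Algebra"
begin

definition char_poly :: "real^'m^'m \<Rightarrow> real poly" where
  "char_poly M = det (\<chi> i j. if i = j then [:- (M $ i $ j), 1:] else [:- (M $ i $ j):])"

text \<open>
  The singular values of an \<open>m \<times> n\<close> matrix \<open>X\<close> with \<open>m \<le> n\<close> are the square roots of the \<open>m\<close>
  eigenvalues of \<open>X X\<^sup>T\<close>, counted with multiplicity. They are listed in decreasing order, so that
  \<open>singular_values X ! i\<close> is the \<open>(i+1)\<close>-st largest one.
\<close>

definition singular_values :: "real^'n^'m \<Rightarrow> real list" where
  "singular_values X =
     rev (sorted_list_of_multiset (image_mset sqrt (proots (char_poly (X ** transpose X)))))"

definition schatten_powr :: "real \<Rightarrow> real^'n^'m \<Rightarrow> real" where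
  "schatten_powr p X = (\<Sum>i<CARD('m). (singular_values X ! i) powr p)"

definition lp_powr :: "real \<Rightarrow> real^'t \<Rightarrow> real" where
  "lp_powr p x = (\<Sum>i\<in>UNIV. \<bar>x $ i\<bar> powr p)"

definition l0_norm :: "real^'t \<Rightarrow> nat" where
  "l0_norm x = card {i. x $ i \<noteq> 0}"

text \<open>\<open>xbar\<close> is the unique optimal solution of minimizing \<open>f x\<close> subject to \<open>C x = y\<close>.\<close>

definition exactly_recovered :: "('a \<Rightarrow> real) \<Rightarrow> ('a \<Rightarrow> 'b) \<Rightarrow> 'b \<Rightarrow> 'a \<Rightarrow> bool" where
  "exactly_recovered f C y xbar \<longleftrightarrow> (\<forall>x. is_arg_min f (\<lambda>z. C z = y) x \<longleftrightarrow> x = xbar)"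

definition recovery_matrices :: "real \<Rightarrow> nat \<Rightarrow> (real^'t^'s) set" where
  "recovery_matrices p k =
     {A. k \<le> CARD('t) \<and>
         (\<forall>xbar y. l0_norm xbar \<le> k \<longrightarrow> y = A *v xbar \<longrightarrow>
            exactly_recovered (lp_powr p) (\<lambda>x. A *v x) y xbar)}"

text \<open>
  The matrix \<open>[Diag(x) 0]\<close>. Rows and columns are indexed by linearly ordered finite types, and
  \<open>card {..<i}\<close> is the (zero-based) position of the index \<open>i\<close>.
\<close>

definition diag_zero ::
  "real^('m::{finite,linorder}) \<Rightarrow> real^('n::{finite,linorder})^('m::{finite,linorder})" where
  "diag_zero x = (\<chi> i j. if card {..<i} = card {..<j} then x $ i else 0)"

end

theory Submission
  imports Defs
begin

unbundle no fps_syntax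

text \<open>
  Applied to the singular value decomposition \<open>U [Diag(w) 0] V\<^sup>T\<close> of a nonzero \<open>W\<close> in the kernel of
  \<open>\<A>\<close>, the hypothesis says that the \<open>k\<close> largest singular values of \<open>W\<close> have a smaller \<open>p\<close>-th power
  sum than the remaining ones. With \<open>W = Xbar - Z\<close> this yields the claim through the perturbation
  inequality \<open>(\<Sum>i. \<bar>\<sigma>\<^sub>i(X)\<^sup>p - \<sigma>\<^sub>i(Y)\<^sup>p\<bar>) \<le> (\<Sum>i. \<sigma>\<^sub>i(X - Y)\<^sup>p)\<close>, because
  \<open>\<sigma>\<^sub>i(Xbar) = 0\<close> beyond the first \<open>k\<close> indices.

  By the triangle inequality along a singular value decomposition of \<open>X - Y\<close>, it suffices to prove
  the perturbation inequality when \<open>X - Y\<close> has rank one and norm \<open>c\<close>. Then the singular values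
  interlace, so the intervals between \<open>\<sigma>\<^sub>i(X)\<close> and \<open>\<sigma>\<^sub>i(Y)\<close> do not overlap, and their total length is
  at most \<open>c\<close>, by eigenvalue monotonicity for the self-adjoint dilation
  \<open>(x, y) \<mapsto> (X y, X\<^sup>T x)\<close>. Concavity of \<open>t \<mapsto> t\<^sup>p\<close> bounds the sum of its increments over
  these intervals by \<open>c\<^sup>p\<close>.
\<close>

section \<open>Eigenvalues of self-adjoint operators\<close>

definition orthonormal_upto :: "nat \<Rightarrow> (nat \<Rightarrow> 'a::real_inner) \<Rightarrow> bool" where
  "orthonormal_upto N e \<longleftrightarrow> (\<forall>i<N. \<forall>j<N. e i \<bullet> e j = (if i = j then 1 else 0))"

definition self_adjoint :: "('a::real_inner \<Rightarrow> 'a) \<Rightarrow> bool" where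
  "self_adjoint T \<longleftrightarrow> linear T \<and> (\<forall>x y. T x \<bullet> y = x \<bullet> T y)"

text \<open>The decreasing order makes \<open>l i\<close> the (i+1)-st largest eigenvalue with
  multiplicity, so that spectra of different operators can be compared index by index.\<close>

definition eigensystem :: "('a::euclidean_space \<Rightarrow> 'a) \<Rightarrow> (nat \<Rightarrow> 'a) \<Rightarrow> (nat \<Rightarrow> real) \<Rightarrow> bool" where
  "eigensystem T e l \<longleftrightarrow> orthonormal_upto DIM('a) e \<and> (\<forall>i<DIM('a). T (e i) = l i *\<^sub>R e i) \<and>
     (\<forall>i j. i \<le> j \<longrightarrow> j < DIM('a) \<longrightarrow> l j \<le> l i)"

section \<open>Orthonormal families and coordinates\<close>

lemma orthonormal_uptoD:
  "orthonormal_upto N e \<Longrightarrow> i < N \<Longrightarrow> j < N \<Longrightarrow> e i \<bullet> e j = (if i = j then 1 else 0)"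
  by (simp add: orthonormal_upto_def)

lemma orthonormal_upto_inj_on: "orthonormal_upto N e \<Longrightarrow> inj_on e {..<N}"
  by (rule inj_onI) (metis lessThan_iff orthonormal_uptoD zero_neq_one)

lemma orthonormal_upto_independent:
  fixes e :: "nat \<Rightarrow> 'a::euclidean_space"
  assumes "orthonormal_upto N e" and "I \<subseteq> {..<N}"
  shows "independent (e ` I)"
proof (rule pairwise_orthogonal_independent)
  show "pairwise orthogonal (e ` I)"
    using assms(2) by (auto simp: pairwise_def orthogonal_def subset_iff orthonormal_uptoD[OF assms(1)])
  show "0 \<notin> e ` I"
  proof
    assume "0 \<in> e ` I"
    then obtain i where "i \<in> I" "e i = 0" by auto
    then show False using assms(2) orthonormal_uptoD[OF assms(1), of i i] by auto
  qed
qed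

lemma orthonormal_upto_dim_span:
  fixes e :: "nat \<Rightarrow> 'a::euclidean_space"
  assumes "orthonormal_upto N e" and "I \<subseteq> {..<N}"
  shows "dim (span (e ` I)) = card I"
  using orthonormal_upto_independent[OF assms] orthonormal_upto_inj_on[OF assms(1)] assms(2)
  by (metis card_image dim_eq_card_independent dim_span inj_on_subset)

lemma orthonormal_upto_span_expansion:
  fixes e :: "nat \<Rightarrow> 'a::euclidean_space"
  assumes "orthonormal_upto N e" and "x \<in> span (e ` I)" and "I \<subseteq> {..<N}"
  shows "x = (\<Sum>i\<in>I. (x \<bullet> e i) *\<^sub>R e i)"
  using assms(2)
proof (induction rule: span_induct_alt)
  case base
  show ?case by simp
next
  case (step c b y)
  then obtain k where k: "k \<in> I" "b = e k" by auto
  have fin: "finite I" using assms(3) finite_subset by blast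
  have "(\<Sum>i\<in>I. ((c *\<^sub>R b + y) \<bullet> e i) *\<^sub>R e i)
      = (\<Sum>i\<in>I. (if i = k then c *\<^sub>R e k else 0) + (y \<bullet> e i) *\<^sub>R e i)"
    using k assms(1,3)
    by (intro sum.cong) (auto simp: inner_add_left scaleR_add_left subset_iff orthonormal_uptoD)
  also have "\<dots> = c *\<^sub>R e k + y"
    using fin k step by (simp add: sum.distrib)
  finally show ?case using k by simp
qed

lemma orthonormal_upto_expansion:
  fixes e :: "nat \<Rightarrow> 'a::euclidean_space"
  assumes "orthonormal_upto DIM('a) e"
  shows "x = (\<Sum>i<DIM('a). (x \<bullet> e i) *\<^sub>R e i)"
proof -
  have "dim (e ` {..<DIM('a)}) = DIM('a)"
    using orthonormal_upto_dim_span[OF assms, of "{..<DIM('a)}"] by simp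
  then have "x \<in> span (e ` {..<DIM('a)})"
    by (metis UNIV_I dim_eq_full)
  then show ?thesis
    using orthonormal_upto_span_expansion[OF assms] by blast
qed

lemma orthonormal_upto_inner:
  fixes e :: "nat \<Rightarrow> 'a::euclidean_space"
  assumes "orthonormal_upto DIM('a) e"
  shows "x \<bullet> y = (\<Sum>i<DIM('a). (x \<bullet> e i) * (y \<bullet> e i))"
proof -
  have "x \<bullet> y = (\<Sum>i<DIM('a). (x \<bullet> e i) *\<^sub>R e i) \<bullet> y"
    using orthonormal_upto_expansion[OF assms, of x] by simp
  also have "\<dots> = (\<Sum>i<DIM('a). (x \<bullet> e i) * (y \<bullet> e i))"
    unfolding inner_sum_left by (simp add: inner_commute[of y])
  finally show ?thesis .
qed

section \<open>Quadratic forms, traces and the spectral theorem\<close>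

lemma eigensystem_quadratic:
  fixes T :: "'a::euclidean_space \<Rightarrow> 'a"
  assumes "linear T" and "eigensystem T e l"
  shows "x \<bullet> T x = (\<Sum>i<DIM('a). l i * (x \<bullet> e i)\<^sup>2)"
proof -
  have on: "orthonormal_upto DIM('a) e" and ev: "\<And>i. i < DIM('a) \<Longrightarrow> T (e i) = l i *\<^sub>R e i"
    using assms(2) by (auto simp: eigensystem_def)
  have "T x = T (\<Sum>i<DIM('a). (x \<bullet> e i) *\<^sub>R e i)"
    using orthonormal_upto_expansion[OF on, of x] by simp
  also have "\<dots> = (\<Sum>i<DIM('a). (x \<bullet> e i) *\<^sub>R (l i *\<^sub>R e i))"
    by (simp add: linear_sum[OF assms(1)] linear_cmul[OF assms(1)] ev)
  finally show ?thesis
    by (simp add: inner_sum_right power2_eq_square algebra_simps)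
qed

lemma eigensystem_trace:
  fixes T :: "'a::euclidean_space \<Rightarrow> 'a"
  assumes "linear T" and "eigensystem T e l"
  shows "(\<Sum>b\<in>Basis. b \<bullet> T b) = (\<Sum>i<DIM('a). l i)"
proof -
  have on: "orthonormal_upto DIM('a) e"
    using assms(2) by (auto simp: eigensystem_def)
  have "(\<Sum>b\<in>Basis. b \<bullet> T b) = (\<Sum>i<DIM('a). l i * (\<Sum>b\<in>Basis. (e i \<bullet> b) * (e i \<bullet> b)))"
    unfolding eigensystem_quadratic[OF assms]
    by (subst sum.swap) (simp add: sum_distrib_left power2_eq_square inner_commute)
  also have "\<dots> = (\<Sum>i<DIM('a). l i)"
    using on by (intro sum.cong) (auto simp: euclidean_inner[symmetric] orthonormal_uptoD)
  finally show ?thesis .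
qed

text \<open>A vector of the span is orthogonal to \<open>c\<close> exactly when it is orthogonal to
  the projection \<open>pr c\<close> of \<open>c\<close> onto the span. The projections of
  \<open>C\<close> are too few to generate the whole span, so a nonzero vector orthogonal to all of
  them remains.\<close>

lemma exists_orthogonal_in_span:
  fixes e :: "nat \<Rightarrow> 'a::euclidean_space"
  assumes on: "orthonormal_upto N e" and I: "I \<subseteq> {..<N}" and C: "finite C" "card C < card I"
  obtains x where "x \<noteq> 0" "x \<in> span (e ` I)" "\<And>c. c \<in> C \<Longrightarrow> x \<bullet> c = 0"
proof -
  define pr where "pr c = (\<Sum>i\<in>I. (c \<bullet> e i) *\<^sub>R e i)" for c
  have pr_in: "pr c \<in> span (e ` I)" for c
    unfolding pr_def by (intro span_sum span_scale span_base) auto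
  have "dim (pr ` C) \<le> card C"
    using C by (meson card_image_le dim_le_card' finite_imageI le_trans)
  also have "\<dots> < dim (span (e ` I))"
    using C orthonormal_upto_dim_span[OF on I] by simp
  finally have "span (pr ` C) \<noteq> span (e ` I)"
    by (metis dim_span nat_neq_iff)
  moreover have "span (pr ` C) \<subseteq> span (e ` I)"
    using pr_in by (intro span_minimal) auto
  ultimately obtain x where x: "x \<noteq> 0" "x \<in> span (e ` I)" "\<And>y. y \<in> span (pr ` C) \<Longrightarrow> orthogonal x y"
    using orthogonal_to_subspace_exists_gen[of "pr ` C" "e ` I"] by blast
  have "x \<bullet> c = 0" if "c \<in> C" for c
  proof -
    have "x \<bullet> pr c = 0"
      using x(3)[of "pr c"] that by (auto simp: orthogonal_def span_base)
    moreover have "x \<bullet> c = (\<Sum>i\<in>I. (x \<bullet> e i) *\<^sub>R e i) \<bullet> c"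
      using orthonormal_upto_span_expansion[OF on x(2) I] by simp
    moreover have "(\<Sum>i\<in>I. (x \<bullet> e i) *\<^sub>R e i) \<bullet> c = x \<bullet> pr c"
      unfolding pr_def inner_sum_left inner_sum_right
      by (intro sum.cong) (simp_all add: inner_commute[of c])
    ultimately show ?thesis by simp
  qed
  with x that show ?thesis by blast
qed

text \<open>A Courant-Fischer argument: orthogonality to \<open>B\<close> and to the first
  \<open>i\<close> eigenvectors of \<open>T\<close> imposes at most \<open>i + d\<close> conditions,
  so the span of the first \<open>i + d + 1\<close> eigenvectors of \<open>S\<close> contains a
  nonzero \<open>x\<close> satisfying them. On this \<open>x\<close> the form of \<open>S\<close> is
  at least \<open>l (i + d)\<close> and that of \<open>T\<close> at most \<open>m i\<close>, times
  \<open>x \<bullet> x\<close>. The case \<open>d = 0\<close> is monotonicity; \<open>d = 1\<close>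
  gives interlacing.\<close>

lemma eigenvalue_shift_le:
  fixes S T :: "'a::euclidean_space \<Rightarrow> 'a"
  assumes S: "linear S" "eigensystem S e l" and T: "linear T" "eigensystem T f m"
    and B: "finite B" "card B \<le> d" and i: "i + d < DIM('a)"
    and le: "\<And>x. (\<And>b. b \<in> B \<Longrightarrow> x \<bullet> b = 0) \<Longrightarrow> x \<bullet> S x \<le> x \<bullet> T x"
  shows "l (i + d) \<le> m i"
proof -
  let ?N = "DIM('a)"
  have on: "orthonormal_upto ?N e" "orthonormal_upto ?N f"
    and mono: "\<And>i j. i \<le> j \<Longrightarrow> j < ?N \<Longrightarrow> l j \<le> l i" "\<And>i j. i \<le> j \<Longrightarrow> j < ?N \<Longrightarrow> m j \<le> m i"
    using S T by (auto simp: eigensystem_def)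
  have I: "{..i + d} \<subseteq> {..<?N}" using i by auto
  have "card (B \<union> f ` {..<i}) \<le> d + i"
    using B(2) card_Un_le[of B "f ` {..<i}"] card_image_le[of "{..<i}" f] by simp
  then have "card (B \<union> f ` {..<i}) < card {..i + d}" by simp
  from exists_orthogonal_in_span[OF on(1) I _ this] B(1)
  obtain x where x: "x \<noteq> 0" "x \<in> span (e ` {..i + d})" "\<And>c. c \<in> B \<union> f ` {..<i} \<Longrightarrow> x \<bullet> c = 0"
    by auto
  have xe: "x \<bullet> e j = 0" if "i + d < j" "j < ?N" for j
  proof -
    have "x \<bullet> e j = (\<Sum>k\<in>{..i+d}. (x \<bullet> e k) *\<^sub>R e k) \<bullet> e j"
      using orthonormal_upto_span_expansion[OF on(1) x(2) I] by simp
    also have "\<dots> = 0"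
      unfolding inner_sum_left using that by (intro sum.neutral) (auto simp: orthonormal_uptoD[OF on(1)])
    finally show ?thesis .
  qed
  have "l (i + d) * (x \<bullet> x) = (\<Sum>j<?N. l (i + d) * (x \<bullet> e j)\<^sup>2)"
    by (subst orthonormal_upto_inner[OF on(1), of x x]) (simp add: sum_distrib_left power2_eq_square)
  also have "\<dots> \<le> (\<Sum>j<?N. l j * (x \<bullet> e j)\<^sup>2)"
  proof (rule sum_mono)
    fix j assume "j \<in> {..<?N}"
    then show "l (i + d) * (x \<bullet> e j)\<^sup>2 \<le> l j * (x \<bullet> e j)\<^sup>2"
      using xe[of j] mono(1)[of j "i + d"] i by (cases "j \<le> i + d") (auto intro: mult_right_mono)
  qed
  also have "\<dots> = x \<bullet> S x" by (simp add: eigensystem_quadratic[OF S])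
  also have "\<dots> \<le> x \<bullet> T x" using x(3) by (intro le) auto
  also have "\<dots> = (\<Sum>j<?N. m j * (x \<bullet> f j)\<^sup>2)" by (simp add: eigensystem_quadratic[OF T])
  also have "\<dots> \<le> (\<Sum>j<?N. m i * (x \<bullet> f j)\<^sup>2)"
  proof (rule sum_mono)
    fix j assume "j \<in> {..<?N}"
    then show "m j * (x \<bullet> f j)\<^sup>2 \<le> m i * (x \<bullet> f j)\<^sup>2"
      using x(3)[of "f j"] mono(2)[of i j] by (cases "j < i") (auto intro: mult_right_mono)
  qed
  also have "\<dots> = m i * (x \<bullet> x)"
    by (subst orthonormal_upto_inner[OF on(2), of x x]) (simp add: sum_distrib_left power2_eq_square)
  finally show ?thesis using x(1) by simp
qed

lemma eigenvalue_mono: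
  fixes S T :: "'a::euclidean_space \<Rightarrow> 'a"
  assumes "linear S" "eigensystem S e l" "linear T" "eigensystem T f m" "i < DIM('a)"
    and "\<And>x. x \<bullet> S x \<le> x \<bullet> T x"
  shows "l i \<le> m i"
  using eigenvalue_shift_le[OF assms(1-4), of "{}" 0 i] assms(5,6) by simp

text \<open>First variation: the residual \<open>y = T e - l e\<close> lies in \<open>S\<close> and
  is orthogonal to \<open>e\<close>. Moving from \<open>e\<close> along \<open>y\<close> would raise
  the Rayleigh quotient to first order unless \<open>y = 0\<close>.\<close>

lemma eigenvector_of_max:
  fixes T :: "'a::real_inner \<Rightarrow> 'a"
  assumes T: "self_adjoint T" and S: "subspace S" "\<And>x. x \<in> S \<Longrightarrow> T x \<in> S"
    and e: "e \<in> S" "norm e = 1"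
    and max: "\<And>x. x \<in> S \<Longrightarrow> norm x = 1 \<Longrightarrow> x \<bullet> T x \<le> e \<bullet> T e"
  shows "T e = (e \<bullet> T e) *\<^sub>R e"
proof -
  have lin: "linear T" and sym: "\<And>x y. T x \<bullet> y = x \<bullet> T y"
    using T by (auto simp: self_adjoint_def)
  define l where "l = e \<bullet> T e"
  have ee: "e \<bullet> e = 1" using e(2) by (simp add: norm_eq_1)
  have q: "x \<bullet> T x \<le> l * (x \<bullet> x)" if "x \<in> S" for x
  proof (cases "x = 0")
    case False
    have "inverse (norm x) *\<^sub>R x \<bullet> T (inverse (norm x) *\<^sub>R x) \<le> l"
      unfolding l_def using that False S(1) by (intro max) (auto simp: subspace_scale)
    then have "(x \<bullet> T x) / (norm x)\<^sup>2 \<le> l"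
      by (simp add: linear_cmul[OF lin] power2_eq_square field_simps)
    then show ?thesis using False by (simp add: divide_le_eq power2_norm_eq_inner)
  qed (simp add: linear_0[OF lin])
  define y where "y = T e - l *\<^sub>R e"
  have yS: "y \<in> S" unfolding y_def using S e by (auto intro: subspace_diff subspace_scale)
  have ye: "e \<bullet> y = 0" by (simp add: y_def inner_diff_right ee l_def)
  have Tey: "T e \<bullet> y = y \<bullet> y"
    using ye by (simp add: y_def inner_diff_left inner_diff_right inner_commute)
  define K where "K = l * (y \<bullet> y) - y \<bullet> T y"
  \<comment> \<open>Maximality at \<open>e + t y\<close>: the linear gain
    \<open>2 t (y \<bullet> y)\<close> cannot exceed the quadratic term.\<close>
  have key: "2 * t * (y \<bullet> y) \<le> t\<^sup>2 * K" for t
  proof -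
    have "(e + t *\<^sub>R y) \<bullet> T (e + t *\<^sub>R y) \<le> l * ((e + t *\<^sub>R y) \<bullet> (e + t *\<^sub>R y))"
      using S(1) e yS by (intro q) (auto intro: subspace_add subspace_scale)
    moreover have "y \<bullet> T e = y \<bullet> y" "e \<bullet> T y = y \<bullet> y" "y \<bullet> e = 0"
      using Tey ye sym[of e y] by (simp_all add: inner_commute)
    ultimately have "l + t * (y \<bullet> y) + (t * (y \<bullet> y) + t * (t * (y \<bullet> T y))) \<le> l * (1 + t * (t * (y \<bullet> y)))"
      by (simp add: linear_add[OF lin] linear_cmul[OF lin] inner_add_left inner_add_right ee ye
          flip: l_def) (simp add: algebra_simps)
    then show ?thesis by (simp add: K_def power2_eq_square algebra_simps)
  qed
  have "y \<bullet> y = 0"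
  proof (rule ccontr)
    assume "y \<bullet> y \<noteq> 0"
    then have pos: "y \<bullet> y > 0" by simp
    \<comment> \<open>Small enough that \<open>t * K\<close> is at most
      \<open>y \<bullet> y\<close>; the added 1 keeps the denominator positive.\<close>
    define t where "t = (y \<bullet> y) / (\<bar>K\<bar> + 1)"
    have t: "t > 0" unfolding t_def using pos by (simp add: add_nonneg_pos)
    from key[of t] have "t * (2 * (y \<bullet> y)) \<le> t * (t * K)"
      by (simp add: power2_eq_square algebra_simps)
    then have "2 * (y \<bullet> y) \<le> t * K" using t by (rule mult_left_le_imp_le)
    also have "\<dots> \<le> t * (\<bar>K\<bar> + 1)" using t by (intro mult_left_mono) auto
    also have "\<dots> = y \<bullet> y" unfolding t_def by (simp add: field_simps)
    finally show False using pos by simp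
  qed
  then show ?thesis by (simp add: y_def l_def)
qed

text \<open>The form with invariant subspaces lets the induction pass to an orthogonal complement.
  Splitting off a maximiser of the quadratic form on the unit sphere makes the new eigenvalue
  dominate all later ones, which yields the order.\<close>

lemma spectral_theorem_subspace:
  fixes T :: "'a::euclidean_space \<Rightarrow> 'a"
  assumes "self_adjoint T" and "subspace S" and "\<And>x. x \<in> S \<Longrightarrow> T x \<in> S" and "dim S = n"
  shows "\<exists>e l. orthonormal_upto n e \<and> (\<forall>i<n. e i \<in> S \<and> T (e i) = l i *\<^sub>R e i) \<and>
           (\<forall>i j. i \<le> j \<longrightarrow> j < n \<longrightarrow> l j \<le> (l i :: real))"
  using assms(2-)
proof (induction n arbitrary: S)
  case 0
  then show ?case by (simp add: orthonormal_upto_def)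
next
  case (Suc n)
  have lin: "linear T" and sym: "\<And>x y. T x \<bullet> y = x \<bullet> T y"
    using assms(1) by (auto simp: self_adjoint_def)
  let ?K = "S \<inter> sphere 0 1"
  have "\<exists>x\<in>S. x \<noteq> 0"
    using Suc.prems(3) by (metis dim_eq_0 subsetI singletonI nat.distinct(1))
  then obtain x where x: "x \<in> S" "x \<noteq> 0" by blast
  then have "inverse (norm x) *\<^sub>R x \<in> ?K"
    using Suc.prems(1) by (auto simp: subspace_scale)
  then have "?K \<noteq> {}" by blast
  moreover have "compact ?K"
    using closed_subspace[OF Suc.prems(1)] by (simp add: closed_Int_compact)
  moreover have "continuous_on ?K (\<lambda>x. x \<bullet> T x)"
    by (intro continuous_intros linear_continuous_on linear_conv_bounded_linear[THEN iffD1] lin)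
  ultimately obtain e0 where e0: "e0 \<in> ?K" "\<And>y. y \<in> ?K \<Longrightarrow> y \<bullet> T y \<le> e0 \<bullet> T e0"
    using continuous_attains_sup by metis
  define l0 where "l0 = e0 \<bullet> T e0"
  have Te0: "T e0 = l0 *\<^sub>R e0"
    unfolding l0_def using e0 Suc.prems by (intro eigenvector_of_max[OF assms(1), of S]) auto
  have ee: "e0 \<bullet> e0 = 1" using e0(1) by (simp add: norm_eq_1)
  \<comment> \<open>The orthogonal complement of \<open>e0\<close> in \<open>S\<close>, written so
    that the dimension formula for complements applies. It is invariant because \<open>T\<close> is
    self-adjoint and \<open>e0\<close> is an eigenvector.\<close>
  define S' where "S' = {y \<in> S. \<forall>x\<in>span {e0}. orthogonal x y}"
  have S'_iff: "y \<in> S' \<longleftrightarrow> y \<in> S \<and> e0 \<bullet> y = 0" for y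
    unfolding S'_def by (auto simp: span_singleton orthogonal_def)
  have "dim S' + dim (span {e0}) = dim S"
    unfolding S'_def using e0(1) Suc.prems(1)
    by (intro dim_subspace_orthogonal_to_vectors) (auto dest!: span_minimal[of "{e0}" S, simplified])
  moreover have "dim (span {e0}) = 1"
  proof -
    have "e0 \<noteq> 0" using ee by auto
    then have "independent {e0}" by simp
    then show ?thesis using dim_eq_card_independent[of "{e0}"] by (simp del: dim_insert)
  qed
  ultimately have "dim S' = n" using Suc.prems(3) by simp
  moreover have "subspace S'"
    using Suc.prems(1) by (auto simp: subspace_def S'_iff inner_add_right)
  moreover have "T x \<in> S'" if "x \<in> S'" for x
    using that Suc.prems(2) sym[of e0 x] Te0 by (auto simp: S'_iff)
  ultimately obtain e l where el: "orthonormal_upto n e" "\<And>i. i < n \<Longrightarrow> e i \<in> S' \<and> T (e i) = l i *\<^sub>R e i"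
     "\<And>i j. i \<le> j \<Longrightarrow> j < n \<Longrightarrow> l j \<le> (l i :: real)"
    using Suc.IH[of S'] by metis
  have l_le: "l i \<le> l0" if "i < n" for i
  proof -
    have "e i \<bullet> e i = 1" using el(1) that by (simp add: orthonormal_uptoD)
    moreover have "e i \<in> ?K" using calculation el(2)[OF that] by (simp add: S'_iff norm_eq_1)
    from e0(2)[OF this] have "e i \<bullet> T (e i) \<le> l0" by (simp add: l0_def)
    ultimately show ?thesis using el(2)[OF that] by simp
  qed
  define e' where "e' = case_nat e0 e"
  define l' where "l' = case_nat l0 l"
  have "e0 \<bullet> e i = 0" "e i \<bullet> e0 = 0" if "i < n" for i
    using el(2)[OF that] by (auto simp: S'_iff inner_commute)
  then have "orthonormal_upto (Suc n) e'"
    using el(1) ee by (auto simp: orthonormal_upto_def e'_def split: nat.split)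
  moreover have "\<forall>i<Suc n. e' i \<in> S \<and> T (e' i) = l' i *\<^sub>R e' i"
    using el(2) Te0 e0(1) by (auto simp: e'_def l'_def S'_iff split: nat.split)
  moreover have "\<forall>i j. i \<le> j \<longrightarrow> j < Suc n \<longrightarrow> l' j \<le> l' i"
    using el(3) l_le by (auto simp: l'_def split: nat.split)
  ultimately show ?case by blast
qed

lemma spectral_theorem:
  fixes T :: "'a::euclidean_space \<Rightarrow> 'a"
  assumes "self_adjoint T"
  obtains e l where "eigensystem T e l"
proof -
  have "\<exists>e l. orthonormal_upto DIM('a) e \<and> (\<forall>i<DIM('a). e i \<in> UNIV \<and> T (e i) = l i *\<^sub>R e i) \<and>
           (\<forall>i j. i \<le> j \<longrightarrow> j < DIM('a) \<longrightarrow> l j \<le> (l i :: real))"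
    by (rule spectral_theorem_subspace[OF assms]) auto
  then show ?thesis using that unfolding eigensystem_def by blast
qed

text \<open>The operator \<open>S + P\<close> dominates both \<open>S\<close> and \<open>T\<close>,
  so each \<open>\<bar>l i - m i\<bar>\<close> is at most \<open>(n i - l i) + (n i - m i)\<close>.
  These terms carry no absolute values, and they sum to traces.\<close>

lemma eigenvalue_perturbation:
  fixes S T P N :: "'a::euclidean_space \<Rightarrow> 'a"
  assumes S: "self_adjoint S" "eigensystem S e l" and T: "self_adjoint T" "eigensystem T f m"
    and P: "self_adjoint P" "\<And>x. 0 \<le> x \<bullet> P x" and N: "self_adjoint N" "\<And>x. 0 \<le> x \<bullet> N x"
    and eq: "\<And>x. T x = S x + P x - N x"
  shows "(\<Sum>i<DIM('a). \<bar>l i - m i\<bar>) \<le> (\<Sum>b\<in>Basis. b \<bullet> P b) + (\<Sum>b\<in>Basis. b \<bullet> N b)"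
proof -
  let ?M = "\<lambda>x. S x + P x"
  have M: "self_adjoint ?M"
    using S(1) P(1) by (auto simp: self_adjoint_def inner_add_left inner_add_right intro: linear_compose_add)
  obtain g n where g: "eigensystem ?M g n" using spectral_theorem[OF M] by blast
  have lin: "linear S" "linear T" "linear ?M" using S T M by (auto simp: self_adjoint_def)
  have "l i \<le> n i" "m i \<le> n i" if "i < DIM('a)" for i
    using eigenvalue_mono[OF lin(1) S(2) lin(3) g that] eigenvalue_mono[OF lin(2) T(2) lin(3) g that]
      P(2) N(2) eq by (auto simp: inner_add_right inner_diff_right)
  then have "(\<Sum>i<DIM('a). \<bar>l i - m i\<bar>) \<le> (\<Sum>i<DIM('a). (n i - l i) + (n i - m i))"
    by (intro sum_mono) (fastforce simp: abs_if)
  also have "\<dots> = 2 * (\<Sum>b\<in>Basis. b \<bullet> ?M b) - (\<Sum>b\<in>Basis. b \<bullet> S b) - (\<Sum>b\<in>Basis. b \<bullet> T b)"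
    using eigensystem_trace[OF lin(1) S(2)] eigensystem_trace[OF lin(2) T(2)] eigensystem_trace[OF lin(3) g]
    by (simp only: sum.distrib sum_subtractf)
  also have "\<dots> = (\<Sum>b\<in>Basis. b \<bullet> P b) + (\<Sum>b\<in>Basis. b \<bullet> N b)"
    by (simp add: eq inner_add_right inner_diff_right sum.distrib sum_subtractf)
  finally show ?thesis .
qed

section \<open>Singular values and the self-adjoint dilation\<close>

lemma poly_det:
  fixes M :: "real poly^'n^'n"
  shows "poly (det M) t = det (\<chi> i j. poly (M $ i $ j) t)"
  by (simp add: det_def poly_sum poly_prod)

lemma poly_char_poly:
  fixes M :: "real^'n^'n"
  shows "poly (char_poly M) t = det (mat t - M)"
  unfolding char_poly_def poly_det
  by (rule arg_cong[where f = det]) (simp add: vec_eq_iff mat_def)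

text \<open>The orthogonal matrix \<open>Q\<close> of eigenvectors diagonalises
  \<open>mat t - M\<close> for every real \<open>t\<close>, and polynomials with equal values
  everywhere are equal. The bijection \<open>g\<close> numbers the matrix indices, whose type
  carries no order here.\<close>

lemma char_poly_eigensystem:
  fixes M :: "real^'n^'n"
  assumes "eigensystem ((*v) M) e l"
  shows "char_poly M = (\<Prod>i<CARD('n). [:- l i, 1:])"
proof -
  have on: "orthonormal_upto CARD('n) e" and ev: "\<And>i. i < CARD('n) \<Longrightarrow> M *v e i = l i *\<^sub>R e i"
    using assms by (auto simp: eigensystem_def)
  obtain g :: "'n \<Rightarrow> nat" where g: "bij_betw g UNIV {..<CARD('n)}"
    using ex_bij_betw_finite_nat[of "UNIV :: 'n set"] by (auto simp: atLeast0LessThan)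
  have g_less: "g i < CARD('n)" and g_eq: "g i = g j \<longleftrightarrow> i = j" for i j
    using g by (auto simp: bij_betw_def inj_on_def)
  define Q :: "real^'n^'n" where "Q = (\<chi> i j. e (g j) $ i)"
  have col: "column j Q = e (g j)" for j
    by (simp add: Q_def column_def vec_eq_iff)
  have "orthogonal_matrix Q"
    unfolding orthogonal_matrix_orthonormal_columns
    by (auto simp: col norm_eq_1 orthogonal_def orthonormal_uptoD[OF on] g_less g_eq)
  then have detQ: "det Q \<noteq> 0" using det_orthogonal_matrix[of Q] by auto
  have "poly (char_poly M) t = poly (\<Prod>i<CARD('n). [:- l i, 1:]) t" for t
  proof -
    define D :: "real^'n^'n" where "D = (\<chi> i j. if i = j then t - l (g j) else 0)"
    have "M *v e (g j) = l (g j) *\<^sub>R e (g j)" for j by (simp add: ev g_less)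
    then have MQ: "(\<Sum>k\<in>UNIV. M $ i $ k * Q $ k $ j) = l (g j) * Q $ i $ j" for i j
      by (simp add: vec_eq_iff matrix_vector_mult_def Q_def)
    have "((mat t - M) ** Q) $ i $ j = (Q ** D) $ i $ j" for i j
    proof -
      have "((mat t - M) ** Q) $ i $ j = (\<Sum>k\<in>UNIV. (if i = k then t * Q $ k $ j else 0)) - l (g j) * Q $ i $ j"
        unfolding MQ[symmetric] sum_subtractf[symmetric] matrix_matrix_mult_def
        by (auto simp: mat_def algebra_simps intro!: sum.cong)
      also have "\<dots> = (\<Sum>k\<in>UNIV. (if k = j then Q $ i $ k * (t - l (g j)) else 0))"
        by (simp add: algebra_simps)
      also have "\<dots> = (Q ** D) $ i $ j"
        by (auto simp: matrix_matrix_mult_def D_def if_distrib cong: if_cong)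
      finally show ?thesis .
    qed
    then have "(mat t - M) ** Q = Q ** D" by (simp add: vec_eq_iff)
    then have "det (mat t - M) * det Q = det Q * det D" by (metis det_mul)
    then have "det (mat t - M) = det D" using detQ by simp
    also have "\<dots> = (\<Prod>i\<in>UNIV. t - l (g i))"
      by (subst det_diagonal) (auto simp: D_def)
    also have "\<dots> = (\<Prod>i<CARD('n). t - l i)"
      by (rule prod.reindex_bij_betw[OF g])
    finally show ?thesis by (simp add: poly_char_poly poly_prod)
  qed
  then show ?thesis by (simp add: poly_eq_poly_eq_iff[symmetric] fun_eq_iff)
qed

text \<open>Connects the multiset of roots with indexed values: the roots are the squares of the
  \<open>s i\<close>, and reversing the sorted list restores the decreasing order that
  \<open>s\<close> already has.\<close>

lemma singular_values_eigensystem: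
  fixes X :: "real^'n^'m"
  assumes es: "eigensystem ((*v) (X ** transpose X)) u (\<lambda>i. (s i)\<^sup>2)"
    and s: "\<And>i. i < CARD('m) \<Longrightarrow> 0 \<le> s i"
  shows "singular_values X = map s [0..<CARD('m)]"
proof -
  let ?m = "CARD('m)"
  have mono: "s j \<le> s i" if "i \<le> j" "j < ?m" for i j
  proof -
    have "(s j)\<^sup>2 \<le> (s i)\<^sup>2" using es that by (auto simp: eigensystem_def)
    then show ?thesis using s[of i] that by (auto intro: power2_le_imp_le)
  qed
  have "proots (char_poly (X ** transpose X)) = (\<Sum>i<?m. {#(s i)\<^sup>2#})"
    by (simp add: char_poly_eigensystem[OF es] proots_prod)
  also have "\<dots> = mset (map (\<lambda>i. (s i)\<^sup>2) [0..<?m])"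
    by (simp add: sum_unfold_sum_mset atLeast0LessThan)
  finally have "image_mset sqrt (proots (char_poly (X ** transpose X)))
      = mset (map (\<lambda>i. sqrt ((s i)\<^sup>2)) [0..<?m])"
    by (simp add: image_mset.compositionality comp_def)
  also have "map (\<lambda>i. sqrt ((s i)\<^sup>2)) [0..<?m] = map s [0..<?m]"
    using s by simp
  finally have "singular_values X = rev (sort (map s [0..<?m]))"
    by (simp only: singular_values_def sorted_list_of_multiset_mset)
  also have "sort (map s [0..<?m]) = rev (map s [0..<?m])"
    using mono by (intro properties_for_sort) (auto simp: sorted_iff_nth_mono rev_nth)
  finally show ?thesis by simp
qed

section \<open>Singular systems and their dilation\<close>

lemma transpose_mult_inner:
  fixes X :: "real^'n^'m"
  shows "(transpose X *v x) \<bullet> y = x \<bullet> (X *v y)"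
  by (simp add: dot_lmul_matrix)

declare transpose_matrix_vector [simp del]

text \<open>The free indices are filled with an orthonormal basis of the orthogonal complement,
  whose dimension is exactly their number.\<close>

lemma orthonormal_extension:
  fixes e :: "nat \<Rightarrow> 'a::euclidean_space"
  assumes I: "I \<subseteq> {..<DIM('a)}" and on: "\<And>i j. i \<in> I \<Longrightarrow> j \<in> I \<Longrightarrow> e i \<bullet> e j = (if i = j then 1 else 0)"
  obtains e' where "orthonormal_upto DIM('a) e'" "\<And>i. i \<in> I \<Longrightarrow> e' i = e i"
proof -
  have fin: "finite I" using I finite_subset by blast
  define S where "S = {y \<in> UNIV. \<forall>x\<in>span (e ` I). orthogonal x y}"
  have "independent (e ` I)"
  proof (rule pairwise_orthogonal_independent)
    show "pairwise orthogonal (e ` I)"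
      by (auto simp: pairwise_def orthogonal_def on)
    show "0 \<notin> e ` I" using on by force
  qed
  moreover have "inj_on e I" by (rule inj_onI) (metis on zero_neq_one)
  ultimately have "dim (span (e ` I)) = card I"
    by (metis card_image dim_eq_card_independent dim_span)
  moreover have "dim S + dim (span (e ` I)) = DIM('a)"
    using dim_subspace_orthogonal_to_vectors[of "span (e ` I)" UNIV] by (simp add: S_def)
  ultimately have dimS: "dim S = card ({..<DIM('a)} - I)"
    using I fin by (simp add: card_Diff_subset)
  have "subspace S"
    by (auto simp: S_def subspace_def orthogonal_def inner_add_right)
  then obtain B where B: "B \<subseteq> S" "pairwise orthogonal B" "\<And>x. x \<in> B \<Longrightarrow> norm x = 1"
      "independent B" "card B = dim S"
    using orthonormal_basis_subspace[of S] by metis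
  have "finite B" using B(4) independent_imp_finite by blast
  then obtain h where h: "bij_betw h ({..<DIM('a)} - I) B"
    using B(5) dimS by (metis finite_Diff finite_lessThan finite_same_card_bij)
  have hB: "h i \<in> B" if "i < DIM('a)" "i \<notin> I" for i
    using h that by (auto simp: bij_betw_def)
  have hh: "h i \<bullet> h j = (if i = j then 1 else 0)" if "i < DIM('a)" "i \<notin> I" "j < DIM('a)" "j \<notin> I" for i j
  proof (cases "i = j")
    case True
    then show ?thesis using B(3)[OF hB[OF that(1,2)]] by (simp add: norm_eq_1)
  next
    case False
    then have "h i \<noteq> h j" using h that by (auto simp: bij_betw_def inj_on_def)
    then show ?thesis using B(2) hB that False by (auto simp: pairwise_def orthogonal_def)
  qed
  have he: "e i \<bullet> h j = 0" "h j \<bullet> e i = 0" if "i \<in> I" "j < DIM('a)" "j \<notin> I" for i j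
    using hB[OF that(2,3)] B(1) that(1) by (auto simp: S_def orthogonal_def span_base inner_commute)
  show ?thesis
    by (rule that[of "\<lambda>i. if i \<in> I then e i else h i"])
      (auto simp: orthonormal_upto_def on hh he)
qed

text \<open>A full singular value decomposition given by vectors: \<open>v\<close> has one vector
  per column of \<open>X\<close>, and those from index \<open>CARD('m)\<close> on are annihilated by
  \<open>X\<close>.\<close>

definition singular_system ::
  "real^'n^'m \<Rightarrow> (nat \<Rightarrow> real^'m) \<Rightarrow> (nat \<Rightarrow> real^'n) \<Rightarrow> (nat \<Rightarrow> real) \<Rightarrow> bool" where
  "singular_system X u v s \<longleftrightarrow> orthonormal_upto CARD('m) u \<and> orthonormal_upto CARD('n) v \<and>
     (\<forall>i<CARD('m). transpose X *v u i = s i *\<^sub>R v i) \<and>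
     (\<forall>j<CARD('n). X *v v j = (if j < CARD('m) then s j *\<^sub>R u j else 0)) \<and>
     (\<forall>i<CARD('m). 0 \<le> s i) \<and> (\<forall>i j. i \<le> j \<longrightarrow> j < CARD('m) \<longrightarrow> s j \<le> s i)"

text \<open>Take eigenvectors \<open>u\<close> of \<open>X ** transpose X\<close>. Their images
  under \<open>transpose X\<close> are pairwise orthogonal with squared norms \<open>l i\<close>;
  the nonzero ones are normalised and then completed to an orthonormal basis
  \<open>v\<close>.\<close>

lemma singular_system_exists:
  fixes X :: "real^'n^'m"
  assumes mn: "CARD('m) \<le> CARD('n)"
  obtains u v s where "singular_system X u v s"
proof -
  let ?m = "CARD('m)" and ?n = "CARD('n)" and ?T = "(*v) (X ** transpose X)"
  have Tx: "?T x = X *v (transpose X *v x)" for x by (simp add: matrix_vector_mul_assoc)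
  have inner_T: "?T x \<bullet> y = (transpose X *v x) \<bullet> (transpose X *v y)" for x y
    unfolding Tx using transpose_mult_inner[of X y "transpose X *v x"] by (simp add: inner_commute)
  have "self_adjoint ?T"
    unfolding self_adjoint_def by (metis inner_T inner_commute matrix_vector_mul_linear)
  then obtain u l where ul: "eigensystem ?T u l" using spectral_theorem by blast
  have on: "orthonormal_upto ?m u" and ev: "\<And>i. i < ?m \<Longrightarrow> X *v (transpose X *v u i) = l i *\<^sub>R u i"
    and lmono: "\<And>i j. i \<le> j \<Longrightarrow> j < ?m \<Longrightarrow> l j \<le> l i"
    using ul unfolding eigensystem_def Tx by auto
  have uu: "(transpose X *v u i) \<bullet> (transpose X *v u j) = (if i = j then l i else 0)" if "i < ?m" "j < ?m" for i j
    using that by (simp add: transpose_mult_inner ev orthonormal_uptoD[OF on])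
  have l0: "0 \<le> l i" if "i < ?m" for i using uu[OF that that] by (metis inner_ge_zero)
  define s where "s i = sqrt (l i)" for i
  have s2: "s i * s i = l i" if "i < ?m" for i using l0[OF that] by (simp add: s_def)
  \<comment> \<open>Only here is the normalisation \<open>w i\<close> meaningful; at the other
    indices below \<open>CARD('m)\<close> the image of \<open>u i\<close> is zero, so any
    \<open>v i\<close> serves.\<close>
  define I where "I = {i. i < ?m \<and> s i \<noteq> 0}"
  define w where "w i = (1 / s i) *\<^sub>R (transpose X *v u i)" for i
  have "I \<subseteq> {..<DIM(real^'n)}" using mn by (auto simp: I_def)
  moreover have "w i \<bullet> w j = (if i = j then 1 else 0)" if "i \<in> I" "j \<in> I" for i j
    using that s2[of i] by (auto simp: w_def I_def uu)
  ultimately obtain v where v: "orthonormal_upto DIM(real^'n) v" "\<And>i. i \<in> I \<Longrightarrow> v i = w i"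
    using orthonormal_extension[of I w] by metis
  have Xu: "transpose X *v u i = s i *\<^sub>R v i" if "i < ?m" for i
  proof (cases "s i = 0")
    case True
    then have "(transpose X *v u i) \<bullet> (transpose X *v u i) = 0"
      using uu[OF that that] s2[OF that] by simp
    then show ?thesis using True by simp
  next
    case False
    then show ?thesis using v(2)[of i] that by (simp add: I_def w_def)
  qed
  \<comment> \<open>The coordinate of \<open>X *v v j\<close> along \<open>u i\<close> is
    \<open>s i * (v i \<bullet> v j)\<close>, so at most the term \<open>i = j\<close> survives, and
    none if \<open>j\<close> is at least \<open>CARD('m)\<close>.\<close>
  have Xv: "X *v v j = (if j < ?m then s j *\<^sub>R u j else 0)" if "j < ?n" for j
  proof -
    have "X *v v j = (\<Sum>i<?m. ((X *v v j) \<bullet> u i) *\<^sub>R u i)"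
      using orthonormal_upto_expansion[of u "X *v v j"] on by simp
    also have "\<dots> = (\<Sum>i<?m. if i = j then s i *\<^sub>R u i else 0)"
    proof (rule sum.cong)
      fix i assume i: "i \<in> {..<?m}"
      then have "(X *v v j) \<bullet> u i = s i * (v i \<bullet> v j)"
        using transpose_mult_inner[of X "u i" "v j"] Xu[of i] by (simp add: inner_commute)
      then show "((X *v v j) \<bullet> u i) *\<^sub>R u i = (if i = j then s i *\<^sub>R u i else 0)"
        using orthonormal_uptoD[OF v(1), of i j] i that mn by auto
    qed simp
    finally show ?thesis by simp
  qed
  have "singular_system X u v s"
    unfolding singular_system_def using on v(1) Xu Xv l0 lmono by (simp add: s_def)
  then show ?thesis by (rule that)
qed

lemma singular_system_eigensystem:
  fixes X :: "real^'n^'m"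
  assumes ss: "singular_system X u v s" and mn: "CARD('m) \<le> CARD('n)"
  shows "eigensystem ((*v) (X ** transpose X)) u (\<lambda>i. (s i)\<^sup>2)"
proof -
  have "(X ** transpose X) *v u i = (s i)\<^sup>2 *\<^sub>R u i" if "i < CARD('m)" for i
  proof -
    have "(X ** transpose X) *v u i = X *v (s i *\<^sub>R v i)"
      using ss that by (simp add: singular_system_def flip: matrix_vector_mul_assoc)
    also have "\<dots> = s i *\<^sub>R (X *v v i)"
      by (simp add: matrix_vector_mult_scaleR)
    finally show ?thesis using ss that mn by (simp add: singular_system_def power2_eq_square)
  qed
  moreover have "(s j)\<^sup>2 \<le> (s i)\<^sup>2" if "i \<le> j" "j < CARD('m)" for i j
    using ss that by (intro power_mono) (auto simp: singular_system_def)
  ultimately show ?thesis using ss by (simp add: eigensystem_def singular_system_def)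
qed

text \<open>The left side does not mention the system, so every decomposition of \<open>X\<close>
  has the same values and any one may be used.\<close>

lemma singular_values_nth:
  fixes X :: "real^'n^'m"
  assumes ss: "singular_system X u v s" and mn: "CARD('m) \<le> CARD('n)" and "i < CARD('m)"
  shows "singular_values X ! i = s i"
  using singular_values_eigensystem[OF singular_system_eigensystem[OF ss mn]] assms
  by (simp add: singular_system_def)

text \<open>Unlike \<open>X ** transpose X\<close>, this operator depends linearly on
  \<open>X\<close>, so an additive change of \<open>X\<close> becomes an additive change of a
  self-adjoint operator.\<close>

definition dilation :: "real^'n^'m \<Rightarrow> (real^'m) \<times> (real^'n) \<Rightarrow> (real^'m) \<times> (real^'n)" where
  "dilation X z = (X *v snd z, transpose X *v fst z)"

lemma self_adjoint_dilation: "self_adjoint (dilation X)"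
proof -
  have "linear (dilation X)"
    by (rule linearI)
      (auto simp: dilation_def matrix_vector_right_distrib matrix_vector_mult_scaleR)
  moreover have "dilation X x \<bullet> y = x \<bullet> dilation X y" for x y
    using transpose_mult_inner[of X "fst x" "snd y"] transpose_mult_inner[of X "fst y" "snd x"]
    by (simp add: dilation_def inner_prod_def inner_commute)
  ultimately show ?thesis by (simp add: self_adjoint_def)
qed

text \<open>Listed by decreasing eigenvalue: \<open>m\<close> values \<open>s i\<close>, then
  \<open>n - m\<close> zeros, then the values \<open>- s i\<close> with the index reversed by
  \<open>m + n - 1 - i\<close>. The factor \<open>1 / sqrt 2\<close> normalises the pairs.\<close>

definition dilation_vec where
  "dilation_vec m n u v i =
     (if i < m then (1 / sqrt 2) *\<^sub>R (u i, v i)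
      else if i < n then (0, v i)
      else (1 / sqrt 2) *\<^sub>R (u (m + n - 1 - i), - v (m + n - 1 - i)))"

definition dilation_val :: "nat \<Rightarrow> nat \<Rightarrow> (nat \<Rightarrow> real) \<Rightarrow> nat \<Rightarrow> real" where
  "dilation_val m n s i =
     (if i < m then s i else if i < n then 0 else - s (m + n - 1 - i))"

lemma eigensystem_dilation:
  fixes X :: "real^'n^'m"
  assumes ss: "singular_system X u v s" and mn: "CARD('m) \<le> CARD('n)"
  shows "eigensystem (dilation X) (dilation_vec CARD('m) CARD('n) u v) (dilation_val CARD('m) CARD('n) s)"
proof -
  let ?m = "CARD('m)" and ?n = "CARD('n)"
  have u: "orthonormal_upto ?m u" and v: "orthonormal_upto ?n v" using ss by (auto simp: singular_system_def)
  have Xu: "\<And>i. i < ?m \<Longrightarrow> transpose X *v u i = s i *\<^sub>R v i"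
    and Xv: "\<And>j. j < ?n \<Longrightarrow> X *v v j = (if j < ?m then s j *\<^sub>R u j else 0)"
    and s0: "\<And>i. i < ?m \<Longrightarrow> 0 \<le> s i" and mono: "\<And>i j. i \<le> j \<Longrightarrow> j < ?m \<Longrightarrow> s j \<le> s i"
    using ss by (auto simp: singular_system_def)
  have "orthonormal_upto (?m + ?n) (dilation_vec ?m ?n u v)"
    unfolding orthonormal_upto_def
  proof (intro allI impI)
    fix i j assume "i < ?m + ?n" "j < ?m + ?n"
    then show "dilation_vec ?m ?n u v i \<bullet> dilation_vec ?m ?n u v j = (if i = j then 1 else 0)"
      using mn by (auto simp: dilation_vec_def inner_prod_def orthonormal_uptoD[OF u] orthonormal_uptoD[OF v])
  qed
  moreover have "dilation X (dilation_vec ?m ?n u v i) = dilation_val ?m ?n s i *\<^sub>R dilation_vec ?m ?n u v i"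
    if "i < ?m + ?n" for i
    using that mn
    by (auto simp: dilation_def dilation_vec_def dilation_val_def Xu Xv matrix_vector_mult_scaleR
        linear_neg[OF matrix_vector_mul_linear])
  moreover have "dilation_val ?m ?n s j \<le> dilation_val ?m ?n s i" if "i \<le> j" "j < ?m + ?n" for i j
  proof -
    have "s (?m + ?n - 1 - i) \<le> s (?m + ?n - 1 - j)" if "\<not> i < ?n"
      using that \<open>i \<le> j\<close> \<open>j < ?m + ?n\<close> by (intro mono) auto
    moreover have "0 \<le> s (?m + ?n - 1 - j)" if "\<not> j < ?n"
      using that \<open>j < ?m + ?n\<close> by (intro s0) auto
    moreover have "i < ?m \<Longrightarrow> 0 \<le> s i" by (rule s0)
    moreover have "j < ?m \<Longrightarrow> s j \<le> s i" using that by (intro mono)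
    ultimately show ?thesis using that mn unfolding dilation_val_def
      by (smt (verit) order_less_le_trans order_le_less_trans)
  qed
  ultimately show ?thesis by (simp add: eigensystem_def)
qed

text \<open>Every singular value occurs in the spectrum of the dilation once with each sign, and the
  zeros cancel.\<close>

lemma sum_dilation_val_diff:
  assumes mn: "m \<le> n"
  shows "(\<Sum>i<m + n. \<bar>dilation_val m n s i - dilation_val m n t i\<bar>) = 2 * (\<Sum>i<m. \<bar>s i - t i\<bar>)"
proof -
  let ?d = "\<lambda>i. \<bar>dilation_val m n s i - dilation_val m n t i\<bar>"
  have "(\<Sum>i<m + n. ?d i) = (\<Sum>i<m. ?d i) + (\<Sum>i=m..<n. ?d i) + (\<Sum>i=n..<m+n. ?d i)"
    using mn by (simp add: lessThan_atLeast0 sum.atLeastLessThan_concat)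
  moreover have "(\<Sum>i<m. ?d i) = (\<Sum>i<m. \<bar>s i - t i\<bar>)"
    by (simp add: dilation_val_def)
  moreover have "(\<Sum>i=m..<n. ?d i) = 0"
    by (simp add: dilation_val_def)
  moreover have "(\<Sum>i=n..<m+n. ?d i) = (\<Sum>i<m. \<bar>s i - t i\<bar>)"
    using mn by (intro sum.reindex_bij_witness[of _ "\<lambda>i. m + n - 1 - i" "\<lambda>i. m + n - 1 - i"])
      (auto simp: dilation_val_def)
  ultimately show ?thesis by simp
qed

section \<open>Perturbation of singular values\<close>

definition outer :: "real^'m \<Rightarrow> real^'n \<Rightarrow> real^'n^'m" where
  "outer a b = (\<chi> i j. a $ i * b $ j)"

lemma outer_mult_vec: "outer a b *v x = (b \<bullet> x) *\<^sub>R a"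
  by (simp add: outer_def vec_eq_iff matrix_vector_mult_def inner_vec_def sum_distrib_left sum_distrib_right algebra_simps)

lemma transpose_outer: "transpose (outer a b) = outer b a"
  by (simp add: outer_def transpose_def vec_eq_iff mult.commute)

lemma transpose_add: "transpose (A + B :: real^'n^'m) = transpose A + transpose B"
  by (simp add: transpose_def vec_eq_iff)

lemma self_adjoint_rank_one:
  fixes a :: "'a::euclidean_space"
  shows "self_adjoint (\<lambda>x. (c * (a \<bullet> x)) *\<^sub>R a)"
  unfolding self_adjoint_def
  by (auto intro!: linearI simp: inner_add_right algebra_simps inner_commute)

lemma rank_one_nonneg:
  fixes a :: "'a::euclidean_space"
  shows "0 \<le> c \<Longrightarrow> 0 \<le> x \<bullet> ((c * (a \<bullet> x)) *\<^sub>R a)"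
  by (simp add: inner_commute[of x a] mult.assoc)

lemma trace_rank_one:
  fixes a :: "'a::euclidean_space"
  shows "(\<Sum>b\<in>Basis. b \<bullet> ((c * (a \<bullet> b)) *\<^sub>R a)) = c * (a \<bullet> a)"
  by (subst euclidean_inner[of a a]) (simp add: sum_distrib_left inner_commute mult.assoc)

text \<open>On the hyperplane orthogonal to \<open>a\<close> the transposes of \<open>X\<close> and
  \<open>Y\<close> agree, hence so do the two quadratic forms. One linear condition costs one
  index.\<close>

lemma singular_values_shift_rank_one:
  fixes X Y :: "real^'n^'m"
  assumes X: "singular_system X u v s" and Y: "singular_system Y u' v' t"
    and mn: "CARD('m) \<le> CARD('n)" and eq: "X = Y + outer a b" and i: "Suc i < CARD('m)"
  shows "s (Suc i) \<le> t i"
proof -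
  have quad: "x \<bullet> ((Z ** transpose Z) *v x) = (transpose Z *v x) \<bullet> (transpose Z *v x)"
    for x and Z :: "real^'n^'m"
    using transpose_mult_inner[of Z x "transpose Z *v x"] by (simp add: matrix_vector_mul_assoc)
  have "(s (i + 1))\<^sup>2 \<le> (t i)\<^sup>2"
  proof (rule eigenvalue_shift_le[OF _ singular_system_eigensystem[OF X mn] _ singular_system_eigensystem[OF Y mn], of "{a}"])
    fix x :: "real^'m" assume "\<And>c. c \<in> {a} \<Longrightarrow> x \<bullet> c = 0"
    then have "a \<bullet> x = 0" by (simp add: inner_commute)
    then have "transpose X *v x = transpose Y *v x"
      by (simp add: eq transpose_add transpose_outer matrix_vector_mult_add_rdistrib outer_mult_vec)
    then show "x \<bullet> ((X ** transpose X) *v x) \<le> x \<bullet> ((Y ** transpose Y) *v x)"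
      by (simp add: quad)
  qed (use i in auto)
  moreover have "0 \<le> t i" using Y i by (simp add: singular_system_def)
  ultimately show ?thesis by (auto intro: power2_le_imp_le)
qed

text \<open>The dilation of a rank-one matrix is a difference of two positive semidefinite operators
  of rank one, since \<open>4 (a \<bullet> x) (b \<bullet> y) = (a \<bullet> x + b \<bullet> y)\<^sup>2 - (a \<bullet> x - b \<bullet> y)\<^sup>2\<close>.\<close>

lemma singular_values_diff_rank_one:
  fixes X Y :: "real^'n^'m"
  assumes X: "singular_system X u v s" and Y: "singular_system Y u' v' t"
    and mn: "CARD('m) \<le> CARD('n)" and eq: "X = Y + outer (c *\<^sub>R a) b"
    and unit: "a \<bullet> a = 1" "b \<bullet> b = 1" and c: "0 \<le> c"
  shows "(\<Sum>i<CARD('m). \<bar>s i - t i\<bar>) \<le> c"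
proof -
  define P where "P x = (c / 2 * ((a, b) \<bullet> x)) *\<^sub>R (a, b)" for x
  define N where "N x = (c / 2 * ((a, -b) \<bullet> x)) *\<^sub>R (a, -b)" for x
  have "2 * (\<Sum>i<CARD('m). \<bar>t i - s i\<bar>)
      = (\<Sum>i<DIM((real^'m) \<times> (real^'n)). \<bar>dilation_val CARD('m) CARD('n) t i - dilation_val CARD('m) CARD('n) s i\<bar>)"
    by (simp add: sum_dilation_val_diff[OF mn])
  also have "\<dots> \<le> (\<Sum>b\<in>Basis. b \<bullet> P b) + (\<Sum>b\<in>Basis. b \<bullet> N b)"
  proof (rule eigenvalue_perturbation[OF self_adjoint_dilation eigensystem_dilation[OF Y mn]
        self_adjoint_dilation eigensystem_dilation[OF X mn]])
    show "self_adjoint P" "self_adjoint N"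
      unfolding P_def N_def by (rule self_adjoint_rank_one)+
    show "0 \<le> x \<bullet> P x" "0 \<le> x \<bullet> N x" for x
      unfolding P_def N_def using c by (intro rank_one_nonneg; simp)+
    show "dilation X x = dilation Y x + P x - N x" for x
    proof (rule prod_eqI)
      show "fst (dilation X x) = fst (dilation Y x + P x - N x)"
        by (simp add: dilation_def P_def N_def eq outer_mult_vec matrix_vector_mult_add_rdistrib
            inner_prod_def algebra_simps flip: scaleR_add_left)
      show "snd (dilation X x) = snd (dilation Y x + P x - N x)"
        by (simp add: dilation_def P_def N_def eq outer_mult_vec transpose_add transpose_outer
            matrix_vector_mult_add_rdistrib inner_prod_def algebra_simps flip: scaleR_add_left)
    qed
  qed
  \<comment> \<open>Each of \<open>P\<close> and \<open>N\<close> has trace \<open>c / 2\<close>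
    times the squared norm 2 of \<open>(a, b)\<close> or \<open>(a, -b)\<close>.\<close>
  also have "\<dots> = 2 * c"
    unfolding P_def N_def trace_rank_one using unit by (simp add: inner_prod_def)
  finally show ?thesis by (simp add: abs_minus_commute)
qed

text \<open>Concavity: the increment over length \<open>d\<close> has derivative
  \<open>p * (x + d) powr (p - 1) - p * x powr (p - 1)\<close>, which is nonpositive as
  \<open>p - 1 < 0\<close>. Derivatives are taken only inside the interval, since \<open>s\<close>
  may be 0.\<close>

lemma powr_diff_antimono:
  fixes p s b d :: real
  assumes p: "0 < p" "p < 1" and "0 \<le> s" "s \<le> b" "0 \<le> d"
  shows "(b + d) powr p - b powr p \<le> (s + d) powr p - s powr p"
proof (rule DERIV_nonpos_imp_decreasing_open[of s b "\<lambda>x. (x + d) powr p - x powr p"])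
  show "s \<le> b" by fact
  show "\<exists>y. ((\<lambda>x. (x + d) powr p - x powr p) has_real_derivative y) (at x) \<and> y \<le> 0"
    if "s < x" "x < b" for x
  proof -
    have x: "0 < x" using that assms by linarith
    have "((\<lambda>x. (x + d) powr p - x powr p) has_real_derivative
        p * (x + d) powr (p - 1) - p * x powr (p - 1)) (at x)"
      using x assms by (auto intro!: derivative_eq_intros)
    moreover have "(x + d) powr (p - 1) \<le> x powr (p - 1)"
      using x assms by (intro powr_mono2') auto
    then have "p * (x + d) powr (p - 1) - p * x powr (p - 1) \<le> 0" using p by simp
    ultimately show ?thesis by blast
  qed
  show "continuous_on {s..b} (\<lambda>x. (x + d) powr p - x powr p)"
    using assms by (auto intro!: continuous_intros continuous_on_powr')
qed

text \<open>The intervals \<open>[b i, a i]\<close> are ordered and disjoint; shifting them towards \<open>0\<close>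
  increases the increments of a concave function.\<close>

lemma sum_powr_diff_le:
  fixes p :: real and a b :: "nat \<Rightarrow> real"
  assumes p: "0 < p" "p < 1"
    and "\<And>i. i < m \<Longrightarrow> 0 \<le> b i \<and> b i \<le> a i" and "\<And>i. Suc i < m \<Longrightarrow> a (Suc i) \<le> b i"
  shows "(\<Sum>i<m. a i powr p - b i powr p) \<le> (\<Sum>i<m. a i - b i) powr p \<and> (0 < m \<longrightarrow> (\<Sum>i<m. a i - b i) \<le> a 0)"
  using assms(3-)
proof (induction m arbitrary: a b)
  case 0
  then show ?case by simp
next
  case (Suc m)
  \<comment> \<open>The total length of all intervals but the topmost,
    \<open>[b 0, a 0]\<close>.\<close>
  define r where "r = (\<Sum>i<m. a (Suc i) - b (Suc i))"
  have IH: "(\<Sum>i<m. a (Suc i) powr p - b (Suc i) powr p) \<le> r powr p" "0 < m \<Longrightarrow> r \<le> a 1"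
    using Suc.IH[of "\<lambda>i. b (Suc i)" "\<lambda>i. a (Suc i)"] Suc.prems by (auto simp: r_def)
  have ab: "0 \<le> b 0" "b 0 \<le> a 0" using Suc.prems(1)[of 0] by auto
  have "0 \<le> r" unfolding r_def using Suc.prems(1) by (intro sum_nonneg) auto
  \<comment> \<open>The second conjunct of the claim serves this step: \<open>r\<close> is at most
    \<open>a 1\<close>, hence at most \<open>b 0\<close>, so the top interval can be moved down to
    start at \<open>r\<close>.\<close>
  moreover have "r \<le> b 0"
  proof (cases "m = 0")
    case False
    then show ?thesis using IH(2) Suc.prems(2)[of 0] by auto
  qed (use ab in \<open>simp add: r_def\<close>)
  ultimately have "(b 0 + (a 0 - b 0)) powr p - b 0 powr p \<le> (r + (a 0 - b 0)) powr p - r powr p"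
    using ab p by (intro powr_diff_antimono) auto
  then show ?case
    using IH(1) \<open>r \<le> b 0\<close> by (simp add: sum.lessThan_Suc_shift add.commute del: sum.lessThan_Suc flip: r_def)
qed

lemma singular_values_powr_diff_rank_one:
  fixes X Y :: "real^'n^'m"
  assumes p: "0 < p" "p < 1"
    and X: "singular_system X u v s" and Y: "singular_system Y u' v' t"
    and mn: "CARD('m) \<le> CARD('n)" and eq: "X = Y + outer (c *\<^sub>R a) b"
    and unit: "a \<bullet> a = 1" "b \<bullet> b = 1" and c: "0 \<le> c"
  shows "(\<Sum>i<CARD('m). \<bar>s i powr p - t i powr p\<bar>) \<le> c powr p"
proof -
  let ?m = "CARD('m)"
  \<comment> \<open>The relation is symmetric up to sign, so the index shift applies in both
    directions.\<close>
  have eq': "Y = X + outer (- c *\<^sub>R a) b"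
    by (simp add: eq outer_def vec_eq_iff)
  have shift: "s (Suc i) \<le> t i" "t (Suc i) \<le> s i" if "Suc i < ?m" for i
    using singular_values_shift_rank_one[OF X Y mn eq that]
      singular_values_shift_rank_one[OF Y X mn eq' that] by auto
  have s: "0 \<le> s i" "0 \<le> t i" if "i < ?m" for i
    using that X Y by (auto simp: singular_system_def)
  have mono: "s (Suc i) \<le> s i" "t (Suc i) \<le> t i" if "Suc i < ?m" for i
    using that X Y by (auto simp: singular_system_def)
  have "(\<Sum>i<?m. \<bar>s i powr p - t i powr p\<bar>) = (\<Sum>i<?m. max (s i) (t i) powr p - min (s i) (t i) powr p)"
  proof (rule sum.cong)
    fix i assume "i \<in> {..<?m}"
    then have *: "0 \<le> s i" "0 \<le> t i" using s by auto
    show "\<bar>s i powr p - t i powr p\<bar> = max (s i) (t i) powr p - min (s i) (t i) powr p"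
    proof (cases "s i \<le> t i")
      case True
      then show ?thesis using powr_mono2[of p "s i" "t i"] * p by (simp add: max_def min_def)
    next
      case False
      then show ?thesis using powr_mono2[of p "t i" "s i"] * p by (simp add: max_def min_def)
    qed
  qed simp
  \<comment> \<open>Shift and monotonicity together put both values at index \<open>i + 1\<close>
    below both values at index \<open>i\<close>, so the intervals do not overlap.\<close>
  also have "\<dots> \<le> (\<Sum>i<?m. max (s i) (t i) - min (s i) (t i)) powr p"
    using shift mono s by (intro sum_powr_diff_le[OF p, THEN conjunct1]) auto
  also have "(\<Sum>i<?m. max (s i) (t i) - min (s i) (t i)) = (\<Sum>i<?m. \<bar>s i - t i\<bar>)"
    by (intro sum.cong) auto
  also have "(\<Sum>i<?m. \<bar>s i - t i\<bar>) powr p \<le> c powr p"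
    using singular_values_diff_rank_one[OF X Y mn eq unit c] p
    by (intro powr_mono2) (auto intro: sum_nonneg)
  finally show ?thesis .
qed

lemma singular_system_decomposition:
  fixes X :: "real^'n^'m"
  assumes ss: "singular_system X u v s" and mn: "CARD('m) \<le> CARD('n)"
  shows "X = (\<Sum>j<CARD('m). outer (s j *\<^sub>R u j) (v j))"
proof -
  have v: "orthonormal_upto CARD('n) v"
    and Xv: "\<And>j. j < CARD('n) \<Longrightarrow> X *v v j = (if j < CARD('m) then s j *\<^sub>R u j else 0)"
    using ss by (auto simp: singular_system_def)
  have sum_mult: "(\<Sum>j\<in>J. outer (s j *\<^sub>R u j) (v j)) *v x = (\<Sum>j\<in>J. outer (s j *\<^sub>R u j) (v j) *v x)"
    if "finite J" for J x
    using that by (induction rule: finite_induct) (simp_all add: matrix_vector_mult_add_rdistrib)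
  have "X *v x = (\<Sum>j<CARD('m). outer (s j *\<^sub>R u j) (v j)) *v x" for x
  proof -
    have "X *v x = X *v (\<Sum>j<CARD('n). (x \<bullet> v j) *\<^sub>R v j)"
      using orthonormal_upto_expansion[of v x] v by simp
    also have "\<dots> = (\<Sum>j<CARD('n). (x \<bullet> v j) *\<^sub>R (X *v v j))"
      by (simp add: linear_sum[OF matrix_vector_mul_linear] matrix_vector_mult_scaleR)
    also have "\<dots> = (\<Sum>j<CARD('m). (x \<bullet> v j) *\<^sub>R (s j *\<^sub>R u j))"
      using mn by (intro sum.mono_neutral_cong_right) (auto simp: Xv)
    finally show ?thesis
      by (simp add: sum_mult outer_mult_vec inner_commute)
  qed
  then show ?thesis by (simp add: matrix_eq)
qed

text \<open>The matrices \<open>?Z N\<close> lead from \<open>Y\<close> to \<open>X\<close> by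
  adding one rank-one term of a decomposition of \<open>X - Y\<close> at a time; the step from
  \<open>N\<close> costs at most \<open>s N powr p\<close>.\<close>

lemma singular_values_powr_diff_le:
  fixes X Y :: "real^'n^'m"
  assumes p: "0 < p" "p < 1" and mn: "CARD('m) \<le> CARD('n)"
  shows "(\<Sum>i<CARD('m). \<bar>(singular_values X ! i) powr p - (singular_values Y ! i) powr p\<bar>)
    \<le> schatten_powr p (X - Y)"
proof -
  let ?m = "CARD('m)"
  obtain u v s where ss: "singular_system (X - Y) u v s"
    using singular_system_exists[OF mn] by blast
  have u: "orthonormal_upto ?m u" and v: "orthonormal_upto CARD('n) v"
    and s: "\<And>j. j < ?m \<Longrightarrow> 0 \<le> s j"
    using ss by (auto simp: singular_system_def)
  let ?Z = "\<lambda>N. Y + (\<Sum>j<N. outer (s j *\<^sub>R u j) (v j))"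
  have "(\<Sum>i<?m. \<bar>(singular_values (?Z N) ! i) powr p - (singular_values Y ! i) powr p\<bar>)
      \<le> (\<Sum>j<N. s j powr p)" if "N \<le> ?m" for N
    using that
  proof (induction N)
    case 0
    then show ?case by simp
  next
    case (Suc N)
    obtain u1 v1 s1 where 1: "singular_system (?Z (Suc N)) u1 v1 s1"
      using singular_system_exists[OF mn] by blast
    obtain u0 v0 s0 where 0: "singular_system (?Z N) u0 v0 s0"
      using singular_system_exists[OF mn] by blast
    have eq: "?Z (Suc N) = ?Z N + outer (s N *\<^sub>R u N) (v N)" by (simp add: algebra_simps)
    have "(\<Sum>i<?m. \<bar>s1 i powr p - s0 i powr p\<bar>) \<le> s N powr p"
      using Suc.prems mn orthonormal_uptoD[OF u, of N N] orthonormal_uptoD[OF v, of N N] s[of N]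
      by (intro singular_values_powr_diff_rank_one[OF p 1 0 mn eq]) auto
    then have "(\<Sum>i<?m. \<bar>(singular_values (?Z (Suc N)) ! i) powr p - (singular_values (?Z N) ! i) powr p\<bar>)
        \<le> s N powr p"
      by (simp add: singular_values_nth[OF 1 mn] singular_values_nth[OF 0 mn] del: sum.lessThan_Suc)
    moreover have "(\<Sum>i<?m. \<bar>(singular_values (?Z (Suc N)) ! i) powr p - (singular_values Y ! i) powr p\<bar>)
      \<le> (\<Sum>i<?m. \<bar>(singular_values (?Z (Suc N)) ! i) powr p - (singular_values (?Z N) ! i) powr p\<bar>
          + \<bar>(singular_values (?Z N) ! i) powr p - (singular_values Y ! i) powr p\<bar>)"
      by (intro sum_mono) linarith
    ultimately show ?case using Suc by (simp add: sum.distrib)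
  qed
  from this[of ?m] have "(\<Sum>i<?m. \<bar>(singular_values X ! i) powr p - (singular_values Y ! i) powr p\<bar>)
      \<le> (\<Sum>j<?m. s j powr p)"
    by (simp flip: singular_system_decomposition[OF ss mn])
  then show ?thesis by (simp add: schatten_powr_def singular_values_nth[OF ss mn])
qed

text \<open>If \<open>s i\<close> were nonzero, \<open>u 0\<close> to \<open>u i\<close> would all
  lie in the range of \<open>X\<close>, giving rank at least \<open>i + 1 > k\<close>; indices start
  at 0.\<close>

lemma singular_values_rank:
  fixes X :: "real^'n^'m"
  assumes ss: "singular_system X u v s" and mn: "CARD('m) \<le> CARD('n)"
    and rk: "rank X \<le> k" and i: "k \<le> i" "i < CARD('m)"
  shows "s i = 0"
proof (rule ccontr)
  assume nz: "s i \<noteq> 0"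
  have u: "orthonormal_upto CARD('m) u" using ss by (auto simp: singular_system_def)
  have "{..i} \<subseteq> {..<CARD('m)}" using i by auto
  have "u ` {..i} \<subseteq> range ((*v) X)"
  proof safe
    fix j assume "j \<le> i"
    then have "s i \<le> s j" "0 \<le> s i" "j < CARD('n)" "j < CARD('m)" using ss i mn by (auto simp: singular_system_def)
    then have "X *v ((1 / s j) *\<^sub>R v j) = u j"
      using ss nz by (auto simp: singular_system_def matrix_vector_mult_scaleR)
    then show "u j \<in> range ((*v) X)" by (metis rangeI)
  qed
  then have "card (u ` {..i}) \<le> rank X"
    unfolding rank_dim_range using orthonormal_upto_independent[OF u, of "{..i}"] \<open>{..i} \<subseteq> {..<CARD('m)}\<close>
    by (intro independent_card_le_dim) auto
  moreover have "card (u ` {..i}) = Suc i"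
    using card_image[OF inj_on_subset[OF orthonormal_upto_inj_on[OF u] \<open>{..i} \<subseteq> {..<CARD('m)}\<close>]] by simp
  ultimately show False using rk i by simp
qed

section \<open>Exact recovery\<close>

lemma card_lessThan_bij_betw:
  "bij_betw (\<lambda>i::'a::{finite,linorder}. card {..<i}) UNIV {..<CARD('a)}"
proof -
  have less: "card {..<i} < card {..<j}" if "i < j" for i j :: 'a
    using that by (intro psubset_card_mono) auto
  have "inj (\<lambda>i::'a. card {..<i})"
    by (rule injI) (metis less linorder_neqE nat_neq_iff)
  moreover have "range (\<lambda>i::'a. card {..<i}) \<subseteq> {..<CARD('a)}"
    by (auto intro!: psubset_card_mono)
  ultimately show ?thesis
    by (simp add: bij_betw_def card_image card_subset_eq)
qed

text \<open>Columns are placed by the same zero-based positions that \<open>diag_zero\<close>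
  uses.\<close>

definition matrix_of_columns ::
  "(nat \<Rightarrow> real^('a::{finite,linorder})) \<Rightarrow> real^('a::{finite,linorder})^('a::{finite,linorder})" where
  "matrix_of_columns e = (\<chi> i j. e (card {..<j}) $ i)"

lemma orthogonal_matrix_of_columns:
  fixes e :: "nat \<Rightarrow> real^'a::{finite,linorder}"
  assumes "orthonormal_upto CARD('a) e"
  shows "orthogonal_matrix (matrix_of_columns e)"
proof -
  have "card {..<i} < CARD('a)" "card {..<i} = card {..<j} \<longleftrightarrow> i = j" for i j :: 'a
    using card_lessThan_bij_betw[where 'a='a] by (auto simp: bij_betw_def inj_on_def)
  moreover have "column j (matrix_of_columns e) = e (card {..<j})" for j :: 'a
    by (simp add: matrix_of_columns_def column_def vec_eq_iff)
  ultimately show ?thesis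
    unfolding orthogonal_matrix_orthonormal_columns
    by (auto simp: norm_eq_1 orthogonal_def orthonormal_uptoD[OF assms])
qed

text \<open>Compare \<open>X ** ?V\<close> and \<open>?U ** ?D\<close> by columns. A column of
  \<open>?D\<close> whose position is at least \<open>CARD('m)\<close> meets no row of equal
  position and vanishes, as does \<open>X *v v j\<close> there.\<close>

lemma singular_value_decomposition:
  fixes X :: "real^('n::{finite,linorder})^('m::{finite,linorder})"
  assumes ss: "singular_system X u v s" and mn: "CARD('m) \<le> CARD('n)"
  shows "X = matrix_of_columns u ** diag_zero (\<chi> i. s (card {..<i})) ** transpose (matrix_of_columns v)"
proof -
  let ?U = "matrix_of_columns u" and ?V = "matrix_of_columns v"
    and ?D = "diag_zero (\<chi> i. s (card {..<i})) :: real^('n::{finite,linorder})^('m::{finite,linorder})"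
  have pos_less: "card {..<j} < CARD('n)" for j :: 'n
    using card_lessThan_bij_betw[where 'a='n] by (auto simp: bij_betw_def)
  have Xv: "\<And>j. j < CARD('n) \<Longrightarrow> X *v v j = (if j < CARD('m) then s j *\<^sub>R u j else 0)"
    using ss by (auto simp: singular_system_def)
  have V: "orthogonal_matrix ?V"
    using ss by (intro orthogonal_matrix_of_columns) (auto simp: singular_system_def)
  have "(X ** ?V) $ i $ j = (?U ** ?D) $ i $ j" for i j
  proof -
    have "(?U ** ?D) $ i $ j
        = (\<Sum>k\<in>(UNIV :: 'm set). (if card {..<k} = card {..<j} then s (card {..<k}) * u (card {..<k}) $ i else 0))"
      unfolding matrix_matrix_mult_def diag_zero_def matrix_of_columns_def vec_lambda_beta
      by (intro sum.cong) auto
    also have "\<dots> = (\<Sum>k<CARD('m). (if k = card {..<j} then s k * u k $ i else 0))"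
      by (rule sum.reindex_bij_betw[OF card_lessThan_bij_betw])
    also have "\<dots> = (X *v v (card {..<j})) $ i"
      by (simp add: Xv pos_less)
    also have "\<dots> = (X ** ?V) $ i $ j"
      by (simp add: matrix_matrix_mult_def matrix_vector_mult_def matrix_of_columns_def)
    finally show ?thesis by simp
  qed
  then have "X ** ?V = ?U ** ?D" by (simp add: vec_eq_iff)
  then have "X ** (?V ** transpose ?V) = ?U ** ?D ** transpose ?V"
    by (simp add: matrix_mul_assoc)
  then show ?thesis using V by (simp add: orthogonal_matrix_def)
qed

lemma lp_powr_positions:
  fixes w :: "real^'m::{finite,linorder}"
  assumes "\<And>i. w $ i = g (card {..<i})"
  shows "lp_powr p w = (\<Sum>i<CARD('m). \<bar>g i\<bar> powr p)"
  unfolding lp_powr_def assms by (rule sum.reindex_bij_betw[OF card_lessThan_bij_betw])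

text \<open>Write the kernel vector as \<open>?h - ?r\<close> with \<open>?h\<close> its first
  \<open>k\<close> entries. Then \<open>?h\<close> is sparse, \<open>?r\<close> has the same image
  and differs from \<open>?h\<close>, so recovery of \<open>?h\<close> makes \<open>?r\<close>
  strictly worse.\<close>

lemma null_space_property:
  fixes A :: "real^('m::{finite,linorder})^'l"
  assumes A: "A \<in> recovery_matrices p k" and z: "A *v (\<chi> i. s (card {..<i})) = 0"
    and nz: "\<exists>i<CARD('m). s i \<noteq> 0"
  shows "(\<Sum>i<k. \<bar>s i\<bar> powr p) < (\<Sum>i=k..<CARD('m). \<bar>s i\<bar> powr p)"
proof -
  let ?m = "CARD('m)"
  define h where "h i = (if i < k then s i else 0)" for i
  define r where "r i = (if i < k then 0 else - s i)" for i
  let ?h = "\<chi> i::'m. h (card {..<i})" and ?r = "\<chi> i::'m. r (card {..<i})"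
  note bij = card_lessThan_bij_betw[where 'a='m]
  have km: "k \<le> ?m" using A by (simp add: recovery_matrices_def)
  have "card {i::'m. ?h $ i \<noteq> 0} = card ((\<lambda>i::'m. card {..<i}) ` {i. ?h $ i \<noteq> 0})"
    using bij by (intro card_image[symmetric]) (auto simp: bij_betw_def inj_on_def)
  also have "\<dots> \<le> card {..<k}"
    by (intro card_mono) (auto simp: h_def split: if_splits)
  finally have "l0_norm ?h \<le> k" by (simp add: l0_norm_def)
  then have "exactly_recovered (lp_powr p) ((*v) A) (A *v ?h) ?h"
    using A by (simp add: recovery_matrices_def)
  then have rec: "is_arg_min (lp_powr p) (\<lambda>x. A *v x = A *v ?h) x \<longleftrightarrow> x = ?h" for x
    by (simp add: exactly_recovered_def)
  have diff: "?h - ?r = (\<chi> i. s (card {..<i}))"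
    by (simp add: vec_eq_iff h_def r_def)
  then have "A *v ?h - A *v ?r = 0" using z by (simp flip: matrix_vector_mult_diff_distrib)
  then have feas: "A *v ?r = A *v ?h" by simp
  obtain i0 where i0: "i0 < ?m" "s i0 \<noteq> 0" using nz by blast
  then obtain j0 :: 'm where "card {..<j0} = i0" using bij by (auto simp: bij_betw_def image_iff set_eq_iff) metis
  then have "?r \<noteq> ?h" using i0 by (auto simp: vec_eq_iff h_def r_def split: if_splits intro!: exI[of _ j0])
  \<comment> \<open>Being feasible but not optimal, \<open>?r\<close> is beaten by some
    \<open>y\<close>, which in turn cannot beat \<open>?h\<close>.\<close>
  then have "\<exists>y. A *v y = A *v ?h \<and> lp_powr p y < lp_powr p ?r"
    using rec[of ?r] feas by (auto simp: is_arg_min_def)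
  moreover have "\<not> (\<exists>y. A *v y = A *v ?h \<and> lp_powr p y < lp_powr p ?h)"
    using rec[of ?h] by (auto simp: is_arg_min_def)
  ultimately have "lp_powr p ?h < lp_powr p ?r" by force
  also have "lp_powr p ?r = (\<Sum>i<?m. \<bar>r i\<bar> powr p)" by (rule lp_powr_positions) simp
  also have "\<dots> = (\<Sum>i=k..<?m. \<bar>s i\<bar> powr p)"
    using km by (intro sum.mono_neutral_cong_right) (auto simp: r_def)
  also have "lp_powr p ?h = (\<Sum>i<?m. \<bar>h i\<bar> powr p)" by (rule lp_powr_positions) simp
  also have "\<dots> = (\<Sum>i<k. \<bar>s i\<bar> powr p)"
    using km by (intro sum.mono_neutral_cong_right) (auto simp: h_def)
  finally show ?thesis .
qed

theorem theorem4:
  fixes p :: real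
    and k :: nat
    and \<A> :: "real^('n::{finite,linorder})^('m::{finite,linorder}) \<Rightarrow> real^'l"
  assumes "0 < p" and "p < 1"
    and "1 \<le> k"
    and "CARD('m) \<le> CARD('n)"
    and "linear \<A>"
    and "\<And>U V. orthogonal_matrix U \<Longrightarrow> orthogonal_matrix V \<Longrightarrow>
           matrix (\<lambda>x. \<A> (U ** diag_zero x ** transpose V)) \<in> recovery_matrices p k"
  shows "\<forall>Xbar y. rank Xbar \<le> k \<longrightarrow> y = \<A> Xbar \<longrightarrow>
           exactly_recovered (schatten_powr p) \<A> y Xbar"
proof (intro allI impI)
  fix X y assume rk: "rank X \<le> k" and y: "y = \<A> X"
  let ?m = "CARD('m)"
  note mn = assms(4)
  \<comment> \<open>Strict superiority over every other feasible point gives both optimality and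
    uniqueness.\<close>
  have less: "schatten_powr p X < schatten_powr p Z" if "\<A> Z = y" "Z \<noteq> X" for Z
  proof -
    obtain u v s where ss: "singular_system (X - Z) u v s"
      using singular_system_exists[OF mn] by blast
    obtain u1 v1 t where X: "singular_system X u1 v1 t"
      using singular_system_exists[OF mn] by blast
    \<comment> \<open>The hypothesis is used for the singular vectors of the kernel element
      \<open>X - Z\<close>.\<close>
    define U V where "U = matrix_of_columns u" and "V = matrix_of_columns v"
    have UV: "orthogonal_matrix U" "orthogonal_matrix V"
      using ss unfolding U_def V_def
      by (auto simp: singular_system_def intro!: orthogonal_matrix_of_columns)
    let ?L = "\<lambda>x. \<A> (U ** diag_zero x ** transpose V)" and ?w = "\<chi> i. s (card {..<i})"
    have svd: "X - Z = U ** diag_zero ?w ** transpose V"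
      unfolding U_def V_def by (rule singular_value_decomposition[OF ss mn])
    \<comment> \<open>Linearity ensures that \<open>matrix ?L\<close> acts as
      \<open>?L\<close>.\<close>
    have "linear (\<lambda>x. U ** diag_zero x ** transpose V)"
      by (rule linearI)
        (simp_all add: vec_eq_iff matrix_matrix_mult_def diag_zero_def sum_distrib_left sum_distrib_right
          sum.distrib[symmetric] algebra_simps if_distrib cong: if_cong)
    then have "linear ?L"
      using linear_compose[OF _ assms(5)] by (simp add: comp_def)
    then have "matrix ?L *v ?w = \<A> (X - Z)"
      by (simp add: svd matrix_works linear_matrix_vector_mul_eq)
    also have "\<dots> = 0"
      using that y by (simp add: linear_diff[OF assms(5)])
    finally have null: "matrix ?L *v ?w = 0" .
    have "\<exists>i<?m. s i \<noteq> 0"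
    proof (rule ccontr)
      assume "\<not> (\<exists>i<?m. s i \<noteq> 0)"
      then have "X - Z = (\<Sum>j<?m. outer 0 (v j))"
        by (subst singular_system_decomposition[OF ss mn]) simp
      also have "\<dots> = 0" by (simp add: outer_def vec_eq_iff)
      finally show False using that by simp
    qed
    then have nsp: "(\<Sum>i<k. \<bar>s i\<bar> powr p) < (\<Sum>i=k..<?m. \<bar>s i\<bar> powr p)"
      by (rule null_space_property[OF assms(6)[OF UV] null])
    have km: "k \<le> ?m" using assms(6)[OF UV] by (simp add: recovery_matrices_def)
    have s0: "0 \<le> s i" if "i < ?m" for i using ss that by (simp add: singular_system_def)
    have "schatten_powr p X = (\<Sum>i<?m. t i powr p)"
      by (simp add: schatten_powr_def singular_values_nth[OF X mn])
    also have "\<dots> = (\<Sum>i<k. t i powr p) + (\<Sum>i=k..<?m. t i powr p)"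
      using km by (simp add: lessThan_atLeast0 sum.atLeastLessThan_concat)
    also have "(\<Sum>i=k..<?m. t i powr p) = 0"
      using singular_values_rank[OF X mn rk] by simp
    also have "(\<Sum>i<k. t i powr p) + 0 < (\<Sum>i<k. t i powr p - \<bar>s i\<bar> powr p) + (\<Sum>i=k..<?m. \<bar>s i\<bar> powr p)"
      using nsp by (simp add: sum_subtractf)
    \<comment> \<open>From index \<open>k\<close> on \<open>t i = 0\<close>, so the absolute
      difference there is exactly \<open>s i powr p\<close>.\<close>
    also have "\<dots> \<le> (\<Sum>i<k. \<bar>t i powr p - s i powr p\<bar>) + (\<Sum>i=k..<?m. \<bar>t i powr p - s i powr p\<bar>)"
      using singular_values_rank[OF X mn rk] s0 km by (intro add_mono sum_mono) auto
    also have "\<dots> = (\<Sum>i<?m. \<bar>t i powr p - s i powr p\<bar>)"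
      using km by (simp add: lessThan_atLeast0 sum.atLeastLessThan_concat)
    also have "\<dots> = (\<Sum>i<?m. \<bar>(singular_values X ! i) powr p - (singular_values (X - Z) ! i) powr p\<bar>)"
      by (simp add: singular_values_nth[OF X mn] singular_values_nth[OF ss mn])
    \<comment> \<open>Comparing \<open>X\<close> with \<open>X - Z\<close> leaves the difference
      \<open>Z\<close>.\<close>
    also have "\<dots> \<le> schatten_powr p (X - (X - Z))"
      by (rule singular_values_powr_diff_le[OF assms(1,2) mn])
    finally show ?thesis by simp
  qed
  have "is_arg_min (schatten_powr p) (\<lambda>z. \<A> z = y) Z \<longleftrightarrow> Z = X" for Z
    using less[of Z] less y by (auto simp: is_arg_min_def) (metis less_asym)
  then show "exactly_recovered (schatten_powr p) \<A> y X"
    by (simp add: exactly_recovered_def)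
qed

end
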